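(* Let $\nu$ be a non-zero finite Borel measure on $(0,1)$. If $\nu$ is $L^q$-regular, then $\nu$ is MF-regular, i.e. $\underline F_\nu=\overline F_\nu$.
   Context: For $n\in\mathbb N$ and $0\le k<2^n$ let $A^n_k:=(k2^{-n},(k+1)2^{-n}]$ and $\mathcal D_{\nu,n}:=\{A^n_k:\nu(A^n_k)>0\}$. For $q\in\mathbb R$ put $\beta^\nu_n(q):=\frac{1}{\log 2^n}\log\sum_{C\in\mathcal D_{\nu,n}}\nu(C)^q$ and $\beta_\nu(q):=\limsup_{n\to\infty}\beta_n^\nu(q)$ (the $L^q$-spectrum). For all large $n$ there is a unique $q_n\ge0$ with $\beta_n^\nu(q_n)=q_n$; $\overline q_\nu:=\limsup_{n\to\infty}q_n$. $\nu$ is called $L^q$-regular if at least one of the following holds: (a) there is $\varepsilon>0$ with $\beta_\nu(q)=\liminf_n\beta_n^\nu(q)$ for all $q\in(\overline q_\nu-\varepsilon,\overline q_\nu)$; (b) $\beta_\nu(\overline q_\nu)=\liminf_n\beta_n^\nu(\overline q_\nu)$ and $\beta_\nu$ is differentiable at $\overline q_\nu$. For $\alpha>0$, $\mathcal N_\alpha(n):=\operatorname{card}\{0\le k<2^n:\nu(A^n_k)\ge2^{-\alpha n}\}$; $\overline F_\nu(\alpha):=\limsup_n\frac{\log^+\mathcal N_\alpha(n)}{\log2^n}$, $\underline F_\nu(\alpha):=\liminf_n\frac{\log^+\mathcal N_\alpha(n)}{\log2^n}$, where $\log^+t=\max(\log t,0)$ and $\log^+0=0$; $\overline F_\nu:=\sup_{\alpha>0}\frac{\overline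 F_\nu(\alpha)}{1+\alpha}$, $\underline F_\nu:=\sup_{\alpha>0}\frac{\underline F_\nu(\alpha)}{1+\alpha}$. $\nu$ is MF-regular if $\underline F_\nu=\overline F_\nu$. *)

theory Defs
  imports "HOL-Analysis.Analysis"
begin

(* A finite Borel measure on the open unit interval is represented by a measure on the Borel sets
   of the real line that gives no mass to the complement of (0,1).  In this way all the half-open
   cells below, including the last one (1 - 2^(-n), 1], which is not a subset of (0,1), are
   measurable. *)
definition borel_measure_on_unit :: "real measure \<Rightarrow> bool" where
  "borel_measure_on_unit \<nu> \<longleftrightarrow>
     finite_measure \<nu> \<and> sets \<nu> = sets borel \<and> emeasure \<nu> (- {0<..<1}) = 0"

definition dyadic_cell :: "nat \<Rightarrow> nat \<Rightarrow> real set" where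
  "dyadic_cell n k = {real k / 2 ^ n <.. (real k + 1) / 2 ^ n}"

definition charged_cells :: "real measure \<Rightarrow> nat \<Rightarrow> real set set" where
  "charged_cells \<nu> n = {dyadic_cell n k | k. k < 2 ^ n \<and> measure \<nu> (dyadic_cell n k) > 0}"

definition beta_level :: "real measure \<Rightarrow> nat \<Rightarrow> real \<Rightarrow> real" where
  "beta_level \<nu> n q = ln (\<Sum>C\<in>charged_cells \<nu> n. measure \<nu> C powr q) / ln (2 ^ n)"

(* For negative q the spectrum may be infinite, hence the extended real values. *)
definition Lq_spectrum :: "real measure \<Rightarrow> real \<Rightarrow> ereal" where
  "Lq_spectrum \<nu> q = limsup (\<lambda>n. ereal (beta_level \<nu> n q))"

definition Lq_spectrum_lower :: "real measure \<Rightarrow> real \<Rightarrow> ereal" where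
  "Lq_spectrum_lower \<nu> q = liminf (\<lambda>n. ereal (beta_level \<nu> n q))"

(* Meaningful for all large n only, see fixed_exponent_ex1 below; the finitely many other values
   do not affect the limit superior. *)
definition fixed_exponent :: "real measure \<Rightarrow> nat \<Rightarrow> real" where
  "fixed_exponent \<nu> n = (THE q. 0 \<le> q \<and> beta_level \<nu> n q = q)"

(* The limit superior is finite, see ereal_upper_fixed_exponent below. *)
definition upper_fixed_exponent :: "real measure \<Rightarrow> real" where
  "upper_fixed_exponent \<nu> = real_of_ereal (limsup (\<lambda>n. ereal (fixed_exponent \<nu> n)))"

(* Differentiability in the usual sense, which includes finiteness near the point
   (real_of_ereal alone would turn infinite values into 0). *)
definition ereal_differentiable_at :: "(real \<Rightarrow> ereal) \<Rightarrow> real \<Rightarrow> bool" where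
  "ereal_differentiable_at f x \<longleftrightarrow>
     (\<forall>\<^sub>F y in nhds x. \<bar>f y\<bar> \<noteq> \<infinity>) \<and> (\<lambda>y. real_of_ereal (f y)) differentiable (at x)"

definition Lq_regular :: "real measure \<Rightarrow> bool" where
  "Lq_regular \<nu> \<longleftrightarrow>
     (\<exists>\<epsilon>>0. \<forall>q\<in>{upper_fixed_exponent \<nu> - \<epsilon> <..< upper_fixed_exponent \<nu>}.
        Lq_spectrum \<nu> q = Lq_spectrum_lower \<nu> q) \<or>
     (Lq_spectrum \<nu> (upper_fixed_exponent \<nu>) = Lq_spectrum_lower \<nu> (upper_fixed_exponent \<nu>) \<and>
      ereal_differentiable_at (Lq_spectrum \<nu>) (upper_fixed_exponent \<nu>))"

definition log_plus :: "real \<Rightarrow> real" where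
  "log_plus t = (if t = 0 then 0 else max (ln t) 0)"

definition heavy_count :: "real measure \<Rightarrow> real \<Rightarrow> nat \<Rightarrow> nat" where
  "heavy_count \<nu> \<alpha> n =
     card {k::nat. k < 2 ^ n \<and> measure \<nu> (dyadic_cell n k) \<ge> 2 powr (- \<alpha> * real n)}"

definition F_upper_at :: "real measure \<Rightarrow> real \<Rightarrow> ereal" where
  "F_upper_at \<nu> \<alpha> = limsup (\<lambda>n. ereal (log_plus (real (heavy_count \<nu> \<alpha> n)) / ln (2 ^ n)))"

definition F_lower_at :: "real measure \<Rightarrow> real \<Rightarrow> ereal" where
  "F_lower_at \<nu> \<alpha> = liminf (\<lambda>n. ereal (log_plus (real (heavy_count \<nu> \<alpha> n)) / ln (2 ^ n)))"

definition F_upper :: "real measure \<Rightarrow> ereal" where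
  "F_upper \<nu> = (SUP \<alpha>\<in>{0<..}. F_upper_at \<nu> \<alpha> / ereal (1 + \<alpha>))"

definition F_lower :: "real measure \<Rightarrow> ereal" where
  "F_lower \<nu> = (SUP \<alpha>\<in>{0<..}. F_lower_at \<nu> \<alpha> / ereal (1 + \<alpha>))"

definition MF_regular :: "real measure \<Rightarrow> bool" where
  "MF_regular \<nu> \<longleftrightarrow> F_lower \<nu> = F_upper \<nu>"


lemma charged_cells_eq:
  "charged_cells \<nu> n =
     dyadic_cell n ` {k. k < 2 ^ n \<and> measure \<nu> (dyadic_cell n k) > 0}"
  by (auto simp: charged_cells_def)

lemma finite_charged_cells: "finite (charged_cells \<nu> n)"
  by (simp add: charged_cells_eq)

lemma card_charged_cells: "card (charged_cells \<nu> n) \<le> 2 ^ n"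
proof -
  have "card (charged_cells \<nu> n) \<le> card {k::nat. k < 2 ^ n \<and> measure \<nu> (dyadic_cell n k) > 0}"
    unfolding charged_cells_eq by (rule card_image_le) simp
  also have "\<dots> \<le> card {..<(2::nat) ^ n}"
    by (rule card_mono) auto
  finally show ?thesis by simp
qed

lemma unit_subset_cells: "{0<..<1} \<subseteq> (\<Union>k\<in>{..<(2::nat) ^ n}. dyadic_cell n k)"
proof
  fix x :: real assume "x \<in> {0<..<1}"
  hence x: "0 < x" "x < 1" by auto
  define k where "k = nat (\<lceil>x * 2 ^ n\<rceil> - 1)"
  have pos: "0 < x * 2 ^ n" using x by simp
  hence "1 \<le> \<lceil>x * 2 ^ n\<rceil>" by linarith
  hence k: "real k = of_int \<lceil>x * 2 ^ n\<rceil> - 1" by (simp add: k_def)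
  have "real k < x * 2 ^ n" "x * 2 ^ n \<le> real k + 1" unfolding k by linarith+
  moreover have "x * 2 ^ n < 2 ^ n" using x by simp
  ultimately have "real k < 2 ^ n" by linarith
  hence "k < 2 ^ n" by (metis of_nat_less_iff of_nat_numeral of_nat_power)
  moreover have "x \<in> dyadic_cell n k"
    using \<open>real k < x * 2 ^ n\<close> \<open>x * 2 ^ n \<le> real k + 1\<close>
    by (simp add: dyadic_cell_def field_simps)
  ultimately show "x \<in> (\<Union>k\<in>{..<(2::nat) ^ n}. dyadic_cell n k)" by blast
qed

lemma charged_cells_nonempty:
  assumes "borel_measure_on_unit \<nu>" "emeasure \<nu> UNIV \<noteq> 0"
  shows "charged_cells \<nu> n \<noteq> {}"
proof
  assume empty: "charged_cells \<nu> n = {}"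
  from assms interpret finite_measure \<nu> by (simp add: borel_measure_on_unit_def)
  have [measurable_cong]: "sets \<nu> = sets borel" and out: "emeasure \<nu> (- {0<..<1}) = 0"
    using assms by (auto simp: borel_measure_on_unit_def)
  have cell: "dyadic_cell n k \<in> null_sets \<nu>" if "k < 2 ^ n" for k
  proof -
    have "measure \<nu> (dyadic_cell n k) = 0"
    proof (rule ccontr)
      assume "measure \<nu> (dyadic_cell n k) \<noteq> 0"
      hence "measure \<nu> (dyadic_cell n k) > 0" by (simp add: zero_less_measure_iff)
      with that have "dyadic_cell n k \<in> charged_cells \<nu> n" by (auto simp: charged_cells_def)
      with empty show False by simp
    qed
    thus ?thesis by (simp add: null_sets_def emeasure_eq_measure dyadic_cell_def)
  qed
  have "(\<Union>k\<in>{..<(2::nat) ^ n}. dyadic_cell n k) \<in> null_sets \<nu>"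
    by (rule null_sets_UN') (auto intro: cell)
  moreover have "- {0<..<1} \<in> null_sets \<nu>"
    using out by (auto simp: null_sets_def)
  ultimately have "- {0<..<1} \<union> (\<Union>k\<in>{..<(2::nat) ^ n}. dyadic_cell n k) \<in> null_sets \<nu>"
    by (rule null_sets.Un[rotated])
  moreover have "- {0<..<1} \<union> (\<Union>k\<in>{..<(2::nat) ^ n}. dyadic_cell n k) = UNIV"
    using unit_subset_cells[of n] by blast
  ultimately show False using assms(2) by auto
qed

lemma fixed_exponent_ex1_bounded:
  assumes "borel_measure_on_unit \<nu>" "emeasure \<nu> UNIV \<noteq> 0"
  shows "\<forall>\<^sub>F n in sequentially.
           (\<exists>!q. 0 \<le> q \<and> beta_level \<nu> n q = q) \<and> fixed_exponent \<nu> n \<in> {0..2}"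
proof -
  from assms interpret finite_measure \<nu> by (simp add: borel_measure_on_unit_def)
  have sets: "sets \<nu> = sets borel" using assms by (auto simp: borel_measure_on_unit_def)
  hence space: "space \<nu> = UNIV" using sets_eq_imp_space_eq by force
  define M where "M = measure \<nu> UNIV"
  have M: "M > 0" using assms(2)
    by (simp add: M_def emeasure_eq_measure measure_nonneg order.not_eq_order_implies_strict
        zero_less_measure_iff)
  have "\<forall>\<^sub>F n in sequentially. real n \<ge> (2 * \<bar>ln M\<bar> + 1) / ln 2"
    using filterlim_real_sequentially by (simp add: filterlim_at_top)
  hence "\<forall>\<^sub>F n in sequentially. real n * ln 2 \<ge> 2 * \<bar>ln M\<bar> + 1"
    by (rule eventually_mono) (simp add: field_simps)
  thus ?thesis
  proof eventually_elim
    case (elim n)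
    define L where "L = ln ((2::real) ^ n)"
    have L: "L \<ge> 2 * \<bar>ln M\<bar> + 1" using elim by (simp add: L_def ln_realpow)
    hence Lpos: "L > 0" by linarith
    define D where "D = charged_cells \<nu> n"
    have fin: "finite D" and ne: "D \<noteq> {}"
      using assms by (auto simp: D_def finite_charged_cells charged_cells_nonempty)
    have Dpos: "measure \<nu> C > 0" if "C \<in> D" for C
      using that by (auto simp: D_def charged_cells_def)
    have DM: "measure \<nu> C \<le> M" for C
      using bounded_measure[of C] by (simp add: M_def space)
    define S where "S = (\<lambda>q. \<Sum>C\<in>D. measure \<nu> C powr q)"
    have Spos: "S q > 0" for q
      unfolding S_def using fin ne Dpos by (intro sum_pos) force+
    have beta: "beta_level \<nu> n q = ln (S q) / L" for q
      by (simp add: beta_level_def S_def D_def L_def)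
    define g where "g = (\<lambda>q. ln (S q) / L - q)"
    have decr: "g q' \<le> g q - (q' - q) / 2" if "q \<le> q'" for q q'
    proof -
      have "S q' \<le> (\<Sum>C\<in>D. M powr (q' - q) * measure \<nu> C powr q)"
        unfolding S_def
      proof (rule sum_mono)
        fix C assume "C \<in> D"
        have "measure \<nu> C powr q' = measure \<nu> C powr (q' - q) * measure \<nu> C powr q"
          by (simp flip: powr_add)
        also have "\<dots> \<le> M powr (q' - q) * measure \<nu> C powr q"
          using that DM by (intro mult_right_mono powr_mono2) auto
        finally show "measure \<nu> C powr q' \<le> M powr (q' - q) * measure \<nu> C powr q" .
      qed
      hence "S q' \<le> M powr (q' - q) * S q" by (simp add: S_def sum_distrib_left)
      hence "ln (S q') \<le> ln (M powr (q' - q) * S q)"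
        using Spos M by simp
      also have "\<dots> = (q' - q) * ln M + ln (S q)"
        using Spos[of q] M by (simp add: ln_mult_pos ln_powr)
      also have "(q' - q) * ln M \<le> (q' - q) * (L / 2)"
        using L that by (intro mult_left_mono) auto
      finally have "ln (S q') / L \<le> ((q' - q) * (L / 2) + ln (S q)) / L"
        using Lpos by (intro divide_right_mono) auto
      also have "\<dots> = (q' - q) / 2 + ln (S q) / L" using Lpos by (simp add: field_simps)
      finally show ?thesis by (simp add: g_def field_simps)
    qed
    have S0: "S 0 = real (card D)"
      unfolding S_def using Dpos by (simp add: less_imp_neq[symmetric] cong: sum.cong)
    have "1 \<le> card D" using fin ne by (simp add: Suc_le_eq card_gt_0_iff)
    hence g0: "0 \<le> g 0" using Lpos by (simp add: g_def S0)
    have "real (card D) \<le> real (2 ^ n)"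
      unfolding D_def of_nat_le_iff by (rule card_charged_cells)
    hence "ln (real (card D)) \<le> L"
      using \<open>1 \<le> card D\<close> by (simp add: L_def)
    hence g1: "g 0 \<le> 1" using Lpos by (simp add: g_def S0)
    have g2: "g 2 \<le> 0" using decr[of 0 2] g1 by simp
    have "continuous_on {0..2} g"
      unfolding g_def S_def using Dpos Spos[unfolded S_def] Lpos
      by (intro continuous_intros) (auto simp: less_imp_neq[symmetric])
    then obtain q where q: "0 \<le> q" "q \<le> 2" "g q = 0"
      using IVT2'[of g 2 0 0] g0 g2 by auto
    have uniq: "p = q" if "g p = 0" for p
      using decr[of p q] decr[of q p] that q(3) by (cases "p \<le> q") auto
    have fp: "beta_level \<nu> n p = p \<longleftrightarrow> g p = 0" for p
      unfolding beta g_def by linarith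
    have ex1: "\<exists>!q. 0 \<le> q \<and> beta_level \<nu> n q = q"
      unfolding fp using q uniq by blast
    moreover have "fixed_exponent \<nu> n = q"
      unfolding fixed_exponent_def
      by (rule the1_equality[OF ex1]) (simp add: fp q)
    ultimately show ?case using q(1,2) by simp
  qed
qed

lemma fixed_exponent_ex1:
  assumes "borel_measure_on_unit \<nu>" "emeasure \<nu> UNIV \<noteq> 0"
  shows "\<forall>\<^sub>F n in sequentially. \<exists>!q. 0 \<le> q \<and> beta_level \<nu> n q = q"
  using fixed_exponent_ex1_bounded[OF assms] by (rule eventually_mono) blast

lemma ereal_upper_fixed_exponent:
  assumes "borel_measure_on_unit \<nu>" "emeasure \<nu> UNIV \<noteq> 0"
  shows "ereal (upper_fixed_exponent \<nu>) = limsup (\<lambda>n. ereal (fixed_exponent \<nu> n))"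
proof -
  have bd: "\<forall>\<^sub>F n in sequentially. fixed_exponent \<nu> n \<in> {0..2}"
    using fixed_exponent_ex1_bounded[OF assms] by (rule eventually_mono) blast
  have "limsup (\<lambda>n. ereal (fixed_exponent \<nu> n)) \<le> ereal 2"
    by (rule Limsup_bounded) (use bd in \<open>auto elim: eventually_mono\<close>)
  moreover have "ereal 0 \<le> liminf (\<lambda>n. ereal (fixed_exponent \<nu> n))"
    by (rule Liminf_bounded) (use bd in \<open>auto elim: eventually_mono\<close>)
  hence "ereal 0 \<le> limsup (\<lambda>n. ereal (fixed_exponent \<nu> n))"
    by (rule order_trans) (rule Liminf_le_Limsup, simp)
  ultimately show ?thesis unfolding upper_fixed_exponent_def
    by (cases "limsup (\<lambda>n. ereal (fixed_exponent \<nu> n))") auto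
qed

end

theory Submission
  imports Defs
begin

text \<open>Both quantities equal the exponent \<open>u\<close>, the upper limit of the fixed points \<open>q\<^sub>n\<close> of the level-\<open>n\<close>
  spectra \<open>\<beta>\<^sub>n\<close>. Chebyshev's inequality in the power sum at \<open>q\<^sub>n\<close> shows that the upper one is at most \<open>u\<close>.
  Conversely, \<open>\<beta>(q) \<ge> u\<close> for \<open>q < u\<close>. If \<open>\<beta>\<^sub>n(q)\<close> converges and \<open>\<beta>\<close> has no noticeable kink between
  \<open>q - h\<close> and \<open>q + h\<close>, then, as in the large deviation lower bound, the power sum at \<open>q\<close> is carried by
  cells of mass about \<open>2 powr (- \<alpha> * n)\<close> with \<open>\<alpha> = - \<beta>'(q)\<close>, of which there must be about
  \<open>2 powr ((\<beta>(q) + \<alpha> * q) * n)\<close>. As \<open>\<beta>(q) \<ge> q\<close>, dividing by \<open>1 + \<alpha>\<close> leaves about \<open>q\<close>.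
  Kinks are excluded by hypothesis in case (b); in case (a) they are avoided by moving \<open>q\<close> slightly
  to the left of \<open>u\<close>.\<close>

section \<open>Dyadic cells and the counting exponents\<close>

text \<open>The right endpoint of a cell determines its index, so counting indices and counting
  cells agree.\<close>

lemma inj_dyadic_cell: "inj (dyadic_cell n)"
proof (rule injI)
  fix j k assume "dyadic_cell n j = dyadic_cell n k"
  moreover have "Sup (dyadic_cell n i) = (real i + 1) / 2 ^ n" for i
    unfolding dyadic_cell_def by (rule cSup_greaterThanAtMost) (simp add: divide_strict_right_mono)
  ultimately have "(real j + 1) / 2 ^ n = (real k + 1) / 2 ^ n" by metis
  thus "j = k" by simp
qed

text \<open>The threshold is positive, so every heavy cell is charged. This makes the count
  comparable with power sums over \<open>charged_cells\<close>; the threshold is written with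
  \<open>exp\<close> and \<open>ln (2 ^ n)\<close> to match \<open>beta_level\<close>.\<close>

lemma heavy_count_eq_card_charged:
  "heavy_count \<nu> \<alpha> n = card {C \<in> charged_cells \<nu> n. measure \<nu> C \<ge> exp (- (\<alpha> * ln (2 ^ n)))}"
proof -
  have e: "2 powr (- \<alpha> * real n) = exp (- (\<alpha> * ln (2 ^ n)))"
    by (simp add: powr_def ln_realpow)
  have "{C \<in> charged_cells \<nu> n. measure \<nu> C \<ge> exp (- (\<alpha> * ln (2 ^ n)))} =
      dyadic_cell n ` {k. k < 2 ^ n \<and> measure \<nu> (dyadic_cell n k) \<ge> 2 powr (- \<alpha> * real n)}"
    unfolding e by (auto simp: charged_cells_def intro: less_le_trans[OF exp_gt_zero])
  thus ?thesis
    by (simp add: heavy_count_def card_image inj_on_subset[OF inj_dyadic_cell])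
qed

lemma tendsto_const_over_level: "(\<lambda>n. c / ln ((2::real) ^ n)) \<longlonglongrightarrow> 0"
proof -
  have "(\<lambda>n. (c / ln 2) / real n) \<longlonglongrightarrow> 0" by (rule lim_const_over_n)
  thus ?thesis by (simp add: ln_realpow mult.commute)
qed

lemma eventually_const_over_level_less:
  assumes "d > 0" shows "\<forall>\<^sub>F n in sequentially. c / ln ((2::real) ^ n) < d"
  using order_tendstoD(2)[OF tendsto_const_over_level assms] .

lemma F_lower_at_nonneg: "0 \<le> F_lower_at \<nu> \<alpha>"
  unfolding F_lower_at_def by (rule Liminf_bounded) (auto simp: log_plus_def)

lemma F_lower_nonneg: "0 \<le> F_lower \<nu>"
proof -
  have "0 \<le> F_lower_at \<nu> 1 / ereal (1 + 1)" using F_lower_at_nonneg by simp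
  also have "\<dots> \<le> F_lower \<nu>" unfolding F_lower_def by (rule SUP_upper) simp
  finally show ?thesis .
qed

lemma F_lower_le_F_upper: "F_lower \<nu> \<le> F_upper \<nu>"
  unfolding F_lower_def F_upper_def
proof (rule SUP_mono, rule bexI)
  fix \<alpha> :: real assume "\<alpha> \<in> {0<..}"
  thus "F_lower_at \<nu> \<alpha> / ereal (1 + \<alpha>) \<le> F_upper_at \<nu> \<alpha> / ereal (1 + \<alpha>)"
    unfolding F_lower_at_def F_upper_at_def
    by (intro ereal_divide_right_mono Liminf_le_Limsup) auto
qed

section \<open>Weighted power sums and second differences\<close>

text \<open>Each term of the power sum at \<open>q\<close> is bounded according to whether the weight
  lies below the window \<open>[exp (- b), exp (- a)]\<close>, inside it, or above it.\<close>

lemma tilted_power_sum_bound: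
  fixes w :: "'a \<Rightarrow> real"
  assumes "finite D" "\<And>C. C \<in> D \<Longrightarrow> 0 < w C" "0 \<le> q" "0 < h"
  shows "(\<Sum>C\<in>D. w C powr q) \<le> real (card {C \<in> D. exp (- b) \<le> w C}) * exp (- a * q)
    + exp (- b * h) * (\<Sum>C\<in>D. w C powr (q - h)) + exp (a * h) * (\<Sum>C\<in>D. w C powr (q + h))"
proof -
  have "w C powr q \<le> (if exp (- b) \<le> w C then exp (- a * q) else 0)
      + exp (- b * h) * w C powr (q - h) + exp (a * h) * w C powr (q + h)"
    if "C \<in> D" for C
  proof -
    define x where "x = ln (w C)"
    have w: "w C = exp x" using assms(2)[OF that] by (simp add: x_def)
    have eqs: "w C powr q = exp (q * x)" "exp (- b * h) * w C powr (q - h) = exp (- b * h + (q - h) * x)"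
      "exp (a * h) * w C powr (q + h) = exp (a * h + (q + h) * x)"
      unfolding w exp_add by (simp_all add: powr_def)
    \<comment> \<open>Since \<open>h > 0\<close>, the factor \<open>w C powr h\<close> is at most
      \<open>exp (- b * h)\<close> below the window, and \<open>w C powr (- h)\<close> is at most
      \<open>exp (a * h)\<close> above it. Inside it, \<open>q \<ge> 0\<close> gives the constant
      bound.\<close>
    consider "x < - b" | "- b \<le> x" "x \<le> - a" | "- a < x" by linarith
    thus ?thesis
    proof cases
      case 1
      hence "x * h \<le> - b * h" using assms by (intro mult_right_mono) auto
      hence "exp (q * x) \<le> exp (- b * h + (q - h) * x)" by (simp add: algebra_simps)
      thus ?thesis unfolding eqs by (smt (verit) exp_gt_zero)
    next
      case 2
      hence "q * x \<le> q * (- a)" using assms by (intro mult_left_mono) auto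
      hence "exp (q * x) \<le> exp (- a * q)" by (simp add: algebra_simps)
      thus ?thesis unfolding eqs using 2 w by (smt (verit) exp_gt_zero exp_le_cancel_iff)
    next
      case 3
      hence "- a * h \<le> x * h" using assms by (intro mult_right_mono) auto
      hence "exp (q * x) \<le> exp (a * h + (q + h) * x)" by (simp add: algebra_simps)
      thus ?thesis unfolding eqs by (smt (verit) exp_gt_zero)
    qed
  qed
  hence "(\<Sum>C\<in>D. w C powr q) \<le> (\<Sum>C\<in>D. (if exp (- b) \<le> w C then exp (- a * q) else 0)
      + exp (- b * h) * w C powr (q - h) + exp (a * h) * w C powr (q + h))"
    by (rule sum_mono)
  also have "\<dots> = real (card {C \<in> D. exp (- b) \<le> w C}) * exp (- a * q)
    + exp (- b * h) * (\<Sum>C\<in>D. w C powr (q - h)) + exp (a * h) * (\<Sum>C\<in>D. w C powr (q + h))"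
    using assms(1) by (simp add: sum.distrib sum_distrib_left sum.If_cases Int_def)
  finally show ?thesis .
qed

text \<open>Halving the step doubles the constant in a bound \<open>c * h \<le> f (x - h) - 2 * f x + f (x + h)\<close>
  that holds on a whole interval, so such a bound cannot hold with \<open>c > 0\<close>.\<close>

lemma ex_small_second_difference:
  fixes f :: "real \<Rightarrow> real"
  assumes "a < b" "c > 0"
  shows "\<exists>x h. 0 < h \<and> a < x - h \<and> x + h < b \<and> f (x - h) - 2 * f x + f (x + h) < c * h"
proof (rule ccontr)
  assume neg: "\<not> ?thesis"
  have base: "c * h \<le> f (x - h) - 2 * f x + f (x + h)" if "0 < h" "a < x - h" "x + h < b" for x h
    using neg that by (meson not_le)
  have iter: "2 ^ k * c * h \<le> f (x - h) - 2 * f x + f (x + h)"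
    if "0 < h" "a < x - h" "x + h < b" for k x h
    using that
  proof (induction k arbitrary: x h)
    case 0
    thus ?case using base by simp
  next
    case (Suc k)
    let ?h = "h / 2"
    have "2 ^ k * c * ?h \<le> f (x - ?h - ?h) - 2 * f (x - ?h) + f (x - ?h + ?h)"
      "2 ^ k * c * ?h \<le> f (x - ?h) - 2 * f x + f (x + ?h)"
      "2 ^ k * c * ?h \<le> f (x + ?h - ?h) - 2 * f (x + ?h) + f (x + ?h + ?h)"
      by (rule Suc.IH; use Suc.prems in \<open>simp add: field_simps\<close>)+
    \<comment> \<open>The three half-step differences are added with weights 1, 2, 1: the values at
      the midpoints cancel and the difference with step \<open>h\<close> remains.\<close>
    hence "4 * (2 ^ k * c * ?h) \<le> f (x - ?h - ?h) - 2 * f x + f (x + ?h + ?h)"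
      unfolding diff_add_cancel add_diff_cancel by linarith
    moreover have "x - ?h - ?h = x - h" "x + ?h + ?h = x + h" by simp_all
    ultimately show ?case by (simp add: mult_ac)
  qed
  define x where "x = (a + b) / 2"
  define h where "h = (b - a) / 4"
  have xh: "0 < h" "a < x - h" "x + h < b" using assms by (auto simp: x_def h_def field_simps)
  obtain k where "(f (x - h) - 2 * f x + f (x + h)) / (c * h) < 2 ^ k"
    using real_arch_pow[of 2] by auto
  hence "f (x - h) - 2 * f x + f (x + h) < 2 ^ k * c * h"
    using xh assms by (simp add: pos_divide_less_eq mult.assoc)
  with iter[OF xh, of k] show False by simp
qed

text \<open>Divided by \<open>h\<close>, the second difference is the right difference quotient
  minus the left one, and both tend to the derivative.\<close>

lemma differentiable_second_difference:
  fixes f :: "real \<Rightarrow> real"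
  assumes "f differentiable (at x)" "c > 0"
  shows "\<forall>\<^sub>F h in at_right 0. f (x - h) - 2 * f x + f (x + h) < c * h"
proof -
  from assms(1) obtain D where D: "(f has_real_derivative D) (at x)"
    by (auto simp: real_differentiable_def)
  hence lim: "((\<lambda>h. (f (x + h) - f x) / h) \<longlongrightarrow> D) (at 0)" by (simp add: DERIV_def)
  have "filterlim (\<lambda>h::real. - h) (at 0) (at_right 0)"
    by (auto simp: filterlim_at intro!: tendsto_eq_intros eventually_at_right_less[of 0, THEN eventually_mono])
  from filterlim_compose[OF lim this] have l: "((\<lambda>h. (f (x - h) - f x) / - h) \<longlongrightarrow> D) (at_right 0)"
    by simp
  have r: "((\<lambda>h. (f (x + h) - f x) / h) \<longlongrightarrow> D) (at_right 0)"
    by (rule tendsto_mono[OF _ lim]) (simp add: at_le)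
  have "((\<lambda>h. (f (x + h) - f x) / h - (f (x - h) - f x) / - h) \<longlongrightarrow> 0) (at_right 0)"
    using tendsto_diff[OF r l] by simp
  from order_tendstoD(2)[OF this assms(2)] eventually_at_right_less[of 0] show ?thesis
  proof eventually_elim
    case (elim h)
    have "(f (x + h) - f x) / h - (f (x - h) - f x) / - h = (f (x - h) - 2 * f x + f (x + h)) / h"
      by (simp add: add_divide_distrib diff_divide_distrib)
    with elim show ?case by (simp add: pos_divide_less_eq)
  qed
qed

section \<open>Level spectra and their fixed exponents\<close>

context
  fixes \<nu> :: "real measure"
  assumes unit: "borel_measure_on_unit \<nu>" and nonzero: "emeasure \<nu> UNIV \<noteq> 0"
begin

lemma charged_sum_pos: "0 < (\<Sum>C\<in>charged_cells \<nu> n. measure \<nu> C powr q)"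
  using finite_charged_cells charged_cells_nonempty[OF unit nonzero]
  by (intro sum_pos) (force simp: charged_cells_def)+

lemma charged_sum_eq_exp_beta_level:
  assumes "n > 0"
  shows "(\<Sum>C\<in>charged_cells \<nu> n. measure \<nu> C powr q) = exp (ln (2 ^ n) * beta_level \<nu> n q)"
proof -
  have "ln ((2::real) ^ n) > 0" using assms by simp
  thus ?thesis using charged_sum_pos[where n = n and q = q] by (simp add: beta_level_def)
qed

lemma total_mass_pos: "0 < measure \<nu> UNIV"
proof -
  interpret finite_measure \<nu> using unit by (simp add: borel_measure_on_unit_def)
  show ?thesis using nonzero by (simp add: emeasure_eq_measure zero_less_measure_iff)
qed

lemma measure_le_total_mass: "measure \<nu> C \<le> measure \<nu> UNIV"
proof -
  interpret finite_measure \<nu> using unit by (simp add: borel_measure_on_unit_def)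
  have "sets \<nu> = sets borel" using unit by (simp add: borel_measure_on_unit_def)
  hence "space \<nu> = UNIV" using sets_eq_imp_space_eq by force
  thus ?thesis using bounded_measure[of C] by simp
qed

text \<open>Masses may exceed 1, so the power sum need not decrease in \<open>q\<close>. Bounding
  the surplus factor \<open>measure \<nu> C powr (q - p)\<close> by the total mass costs an error
  that vanishes as the level grows.\<close>

lemma beta_level_almost_antimono:
  assumes "n > 0" "p \<le> q"
  shows "beta_level \<nu> n q \<le> beta_level \<nu> n p + (q - p) * (\<bar>ln (measure \<nu> UNIV)\<bar> / ln (2 ^ n))"
proof -
  let ?M = "measure \<nu> UNIV" and ?S = "\<lambda>q. \<Sum>C\<in>charged_cells \<nu> n. measure \<nu> C powr q"
  have L: "ln ((2::real) ^ n) > 0" using assms by simp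
  have "?S q \<le> (\<Sum>C\<in>charged_cells \<nu> n. ?M powr (q - p) * measure \<nu> C powr p)"
  proof (rule sum_mono)
    fix C
    have "measure \<nu> C powr q = measure \<nu> C powr (q - p) * measure \<nu> C powr p"
      by (simp flip: powr_add)
    also have "\<dots> \<le> ?M powr (q - p) * measure \<nu> C powr p"
      using assms measure_le_total_mass by (intro mult_right_mono powr_mono2) auto
    finally show "measure \<nu> C powr q \<le> ?M powr (q - p) * measure \<nu> C powr p" .
  qed
  hence "?S q \<le> ?M powr (q - p) * ?S p" by (simp add: sum_distrib_left)
  hence "ln (?S q) \<le> ln (?M powr (q - p) * ?S p)"
    using charged_sum_pos[where n = n and q = q] by simp
  also have "\<dots> = (q - p) * ln ?M + ln (?S p)"
    using charged_sum_pos[where n = n and q = p] total_mass_pos by (simp add: ln_mult_pos ln_powr)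
  also have "\<dots> \<le> (q - p) * \<bar>ln ?M\<bar> + ln (?S p)"
    using assms by (intro add_right_mono mult_left_mono) auto
  finally have "ln (?S q) / ln (2 ^ n) \<le> ((q - p) * \<bar>ln ?M\<bar> + ln (?S p)) / ln (2 ^ n)"
    using L by (intro divide_right_mono) auto
  thus ?thesis by (simp add: beta_level_def add_divide_distrib)
qed

text \<open>The error in \<open>beta_level_almost_antimono\<close> disappears in the limit. As the
  spectrum may be infinite, the comparison goes through real upper bounds.\<close>

lemma Lq_spectrum_antimono:
  assumes "p \<le> q" shows "Lq_spectrum \<nu> q \<le> Lq_spectrum \<nu> p"
proof (rule ereal_le_real)
  fix x assume "Lq_spectrum \<nu> p \<le> ereal x"
  show "Lq_spectrum \<nu> q \<le> ereal x"
  proof (rule ereal_le_epsilon2)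
    fix e :: real assume e: "0 < e"
    have "Lq_spectrum \<nu> p < ereal (x + e / 2)"
      using \<open>Lq_spectrum \<nu> p \<le> ereal x\<close> e by (auto elim: le_less_trans)
    hence "\<forall>\<^sub>F n in sequentially. ereal (beta_level \<nu> n p) < ereal (x + e / 2)"
      unfolding Lq_spectrum_def by (rule Limsup_lessD)
    moreover have "\<forall>\<^sub>F n in sequentially. (q - p) * \<bar>ln (measure \<nu> UNIV)\<bar> / ln ((2::real) ^ n) < e / 2"
      by (rule eventually_const_over_level_less) (use e in simp)
    ultimately have "\<forall>\<^sub>F n in sequentially. ereal (beta_level \<nu> n q) \<le> ereal (x + e)"
      using eventually_gt_at_top[of 0]
    proof eventually_elim
      case (elim n)
      hence "beta_level \<nu> n p < x + e / 2" by simp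
      with elim(2) beta_level_almost_antimono[OF elim(3) assms] have "beta_level \<nu> n q \<le> x + e"
        unfolding times_divide_eq_right by linarith
      thus ?case by simp
    qed
    thus "Lq_spectrum \<nu> q \<le> ereal x + ereal e"
      unfolding Lq_spectrum_def by (simp add: Limsup_bounded)
  qed
qed

text \<open>At exponent 0 the power sum counts at most \<open>2 ^ n\<close> cells. This provides
  finiteness of the spectrum for nonnegative exponents from above.\<close>

lemma Lq_spectrum_le_one:
  assumes "0 \<le> q" shows "Lq_spectrum \<nu> q \<le> 1"
proof -
  have "Lq_spectrum \<nu> q \<le> Lq_spectrum \<nu> 0" using assms by (rule Lq_spectrum_antimono)
  also have "\<dots> \<le> 1"
    unfolding Lq_spectrum_def
  proof (rule Limsup_bounded, rule eventually_mono[OF eventually_gt_at_top[of 0]])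
    fix n :: nat assume n: "n > 0"
    have "(\<Sum>C\<in>charged_cells \<nu> n. measure \<nu> C powr 0) \<le> (\<Sum>C\<in>charged_cells \<nu> n. 1)"
      by (intro sum_mono) auto
    also have "\<dots> \<le> real (2 ^ n)"
      unfolding sum_constant by (simp only: mult_1_right of_nat_le_iff card_charged_cells)
    finally have "ln (\<Sum>C\<in>charged_cells \<nu> n. measure \<nu> C powr 0) \<le> ln (2 ^ n)"
      using charged_sum_pos[where n = n and q = 0] by simp
    thus "ereal (beta_level \<nu> n 0) \<le> 1" using n by (simp add: beta_level_def)
  qed
  finally show ?thesis .
qed

lemma eventually_fixed_exponent:
  "\<forall>\<^sub>F n in sequentially. 0 \<le> fixed_exponent \<nu> n \<and> fixed_exponent \<nu> n \<le> 2 \<and>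
     beta_level \<nu> n (fixed_exponent \<nu> n) = fixed_exponent \<nu> n"
  using fixed_exponent_ex1_bounded[OF unit nonzero]
proof eventually_elim
  case (elim n)
  hence "\<exists>!q. 0 \<le> q \<and> beta_level \<nu> n q = q" by blast
  from theI'[OF this] elim show ?case unfolding fixed_exponent_def by simp
qed

lemma upper_fixed_exponent_nonneg: "0 \<le> upper_fixed_exponent \<nu>"
proof -
  have "0 \<le> liminf (\<lambda>n. ereal (fixed_exponent \<nu> n))"
    by (rule Liminf_bounded) (use eventually_fixed_exponent in \<open>auto elim: eventually_mono\<close>)
  also have "\<dots> \<le> limsup (\<lambda>n. ereal (fixed_exponent \<nu> n))"
    by (rule Liminf_le_Limsup) simp
  also have "\<dots> = ereal (upper_fixed_exponent \<nu>)"
    by (rule ereal_upper_fixed_exponent[OF unit nonzero, symmetric])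
  finally show ?thesis by simp
qed

text \<open>If the spectrum at \<open>q\<close> were smaller, near monotonicity would force the
  fixed points, being values of \<open>beta_level\<close> at themselves, to stay eventually below
  some \<open>t < upper_fixed_exponent \<nu>\<close>.\<close>

lemma upper_fixed_exponent_le_Lq_spectrum:
  assumes "q < upper_fixed_exponent \<nu>"
  shows "ereal (upper_fixed_exponent \<nu>) \<le> Lq_spectrum \<nu> q"
proof (rule dense_le)
  fix x assume x: "x < ereal (upper_fixed_exponent \<nu>)"
  show "x \<le> Lq_spectrum \<nu> q"
  proof (rule ccontr)
    assume "\<not> ?thesis"
    hence "Lq_spectrum \<nu> q < x" by simp
    then obtain y where y: "Lq_spectrum \<nu> q < ereal y" "ereal y < x"
      using ereal_dense2 by blast
    with x have yu: "y < upper_fixed_exponent \<nu>" by (metis less_ereal.simps(1) less_trans)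
    \<comment> \<open>Above \<open>q\<close>, so that monotonicity applies to fixed points beyond
      \<open>t\<close>; above \<open>y\<close>, to leave room for the error; below the upper limit,
      for the contradiction.\<close>
    define t where "t = (max q y + upper_fixed_exponent \<nu>) / 2"
    have t: "q < t" "y < t" "t < upper_fixed_exponent \<nu>"
      using yu assms by (auto simp: t_def)
    have "\<forall>\<^sub>F n in sequentially. ereal (beta_level \<nu> n q) < ereal y"
      using y(1) unfolding Lq_spectrum_def by (rule Limsup_lessD)
    \<comment> \<open>Fixed points are eventually at most 2, so \<open>2 - q\<close> bounds the
      distance from \<open>q\<close> to all of them and makes the error uniform.\<close>
    moreover have "\<forall>\<^sub>F n in sequentially.
        (2 - q) * \<bar>ln (measure \<nu> UNIV)\<bar> / ln ((2::real) ^ n) < t - y"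
      by (rule eventually_const_over_level_less) (use t in simp)
    ultimately have "\<forall>\<^sub>F n in sequentially. ereal (fixed_exponent \<nu> n) \<le> ereal t"
      using eventually_fixed_exponent eventually_gt_at_top[of 0]
    proof eventually_elim
      case (elim n)
      let ?r = "fixed_exponent \<nu> n"
      show ?case
      proof (rule ccontr)
        assume "\<not> ?thesis"
        hence r: "t < ?r" by simp
        have "?r \<le> beta_level \<nu> n q + (?r - q) * (\<bar>ln (measure \<nu> UNIV)\<bar> / ln (2 ^ n))"
          using beta_level_almost_antimono[of n q ?r] elim r t by simp
        also have "\<dots> \<le> beta_level \<nu> n q + (2 - q) * (\<bar>ln (measure \<nu> UNIV)\<bar> / ln (2 ^ n))"
          using elim by (intro add_left_mono mult_right_mono) auto
        finally show False using elim r by simp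
      qed
    qed
    hence "limsup (\<lambda>n. ereal (fixed_exponent \<nu> n)) \<le> ereal t" by (rule Limsup_bounded)
    thus False using ereal_upper_fixed_exponent[OF unit nonzero, symmetric] t by simp
  qed
qed

section \<open>Upper bound by Chebyshev's inequality\<close>

text \<open>At a fixed point \<open>r\<close> the power sum is \<open>exp (L * r)\<close>, while
  each heavy cell contributes at least \<open>exp (- (\<alpha> * L * r))\<close>. Hence the count is
  at most \<open>exp ((1 + \<alpha>) * r * L)\<close>, which explains the divisor
  \<open>1 + \<alpha>\<close>.\<close>

lemma F_upper_le: "F_upper \<nu> \<le> ereal (upper_fixed_exponent \<nu>)"
  unfolding F_upper_def
proof (rule SUP_least)
  fix \<alpha> :: real assume "\<alpha> \<in> {0<..}"
  hence \<alpha>: "\<alpha> > 0" by simp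
  have "F_upper_at \<nu> \<alpha> \<le> limsup (\<lambda>n. ereal (1 + \<alpha>) * ereal (fixed_exponent \<nu> n))"
    unfolding F_upper_at_def
  proof (rule Limsup_mono)
    show "\<forall>\<^sub>F n in sequentially. ereal (log_plus (real (heavy_count \<nu> \<alpha> n)) / ln (2 ^ n))
            \<le> ereal (1 + \<alpha>) * ereal (fixed_exponent \<nu> n)"
      using eventually_fixed_exponent eventually_gt_at_top[of 0]
    proof eventually_elim
      case (elim n)
      let ?r = "fixed_exponent \<nu> n" and ?N = "heavy_count \<nu> \<alpha> n"
      define L where "L = ln ((2::real) ^ n)"
      have L: "L > 0" using elim by (simp add: L_def)
      let ?H = "{C \<in> charged_cells \<nu> n. measure \<nu> C \<ge> exp (- (\<alpha> * L))}"
      have "real ?N * exp (- (\<alpha> * L)) powr ?r = (\<Sum>C\<in>?H. exp (- (\<alpha> * L)) powr ?r)"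
        by (simp add: heavy_count_eq_card_charged L_def)
      also have "\<dots> \<le> (\<Sum>C\<in>?H. measure \<nu> C powr ?r)"
        using elim by (intro sum_mono powr_mono2) auto
      also have "\<dots> \<le> (\<Sum>C\<in>charged_cells \<nu> n. measure \<nu> C powr ?r)"
        by (intro sum_mono2 finite_charged_cells) auto
      also have "\<dots> = exp (L * ?r)"
        using charged_sum_eq_exp_beta_level[where n = n and q = "?r"] elim by (simp add: L_def)
      finally have "real ?N \<le> exp (L * ?r) / exp (- (\<alpha> * L)) powr ?r"
        by (simp add: field_simps)
      also have "\<dots> = exp ((1 + \<alpha>) * ?r * L)"
        by (simp add: powr_def algebra_simps flip: exp_diff)
      finally have "?N > 0 \<Longrightarrow> ln (real ?N) \<le> ln (exp ((1 + \<alpha>) * ?r * L))"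
        by (subst ln_le_cancel_iff) auto
      \<comment> \<open>Covers the truncation in \<open>log_plus\<close>, including the case of no
        heavy cells.\<close>
      moreover have "0 \<le> (1 + \<alpha>) * ?r * L" using elim L \<alpha> by simp
      ultimately have "log_plus (real ?N) \<le> (1 + \<alpha>) * ?r * L"
        by (auto simp: log_plus_def)
      thus ?case using L by (simp add: L_def[symmetric] pos_divide_le_eq)
    qed
  qed
  also have "\<dots> = ereal (1 + \<alpha>) * limsup (\<lambda>n. ereal (fixed_exponent \<nu> n))"
    using \<alpha> by (intro Limsup_ereal_mult_left) auto
  also have "\<dots> = ereal (1 + \<alpha>) * ereal (upper_fixed_exponent \<nu>)"
    by (simp only: ereal_upper_fixed_exponent[OF unit nonzero])
  finally show "F_upper_at \<nu> \<alpha> / ereal (1 + \<alpha>) \<le> ereal (upper_fixed_exponent \<nu>)"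
    using \<alpha> by (cases "F_upper_at \<nu> \<alpha>") (auto simp: divide_simps mult.commute)
qed

section \<open>Lower bound by a large deviation estimate\<close>

text \<open>The window in \<open>tilted_power_sum_bound\<close> is set by the negated secant slopes
  of the spectrum to the left and right of \<open>q\<close>, widened by \<open>c\<close> on each
  side. The margin makes the cells outside it negligible in the power sum at \<open>q\<close>, so
  the heavy cells must be numerous.\<close>

lemma F_lower_at_ge:
  assumes q: "0 \<le> q" and h: "0 < h" and d: "0 < d" "4 * d \<le> c * h"
    and low: "ereal b\<^sub>0 \<le> Lq_spectrum_lower \<nu> q"
    and left: "Lq_spectrum \<nu> (q - h) \<le> ereal b\<^sub>1"
    and right: "Lq_spectrum \<nu> (q + h) \<le> ereal b\<^sub>2"
  shows "ereal (b\<^sub>0 + ((b\<^sub>0 - b\<^sub>2) / h - c) * q - 2 * d) \<le> F_lower_at \<nu> ((b\<^sub>1 - b\<^sub>0) / h + c)"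
  unfolding F_lower_at_def
proof (rule Liminf_bounded)
  let ?\<alpha> = "(b\<^sub>1 - b\<^sub>0) / h + c" and ?\<gamma> = "(b\<^sub>0 - b\<^sub>2) / h - c"
  have "ereal (b\<^sub>0 - d) < Lq_spectrum_lower \<nu> q"
    by (rule less_le_trans[OF _ low]) (use d in simp)
  hence "\<forall>\<^sub>F n in sequentially. ereal (b\<^sub>0 - d) < ereal (beta_level \<nu> n q)"
    unfolding Lq_spectrum_lower_def by (rule less_LiminfD)
  moreover have "Lq_spectrum \<nu> (q - h) < ereal (b\<^sub>1 + d)"
    by (rule le_less_trans[OF left]) (use d in simp)
  hence "\<forall>\<^sub>F n in sequentially. ereal (beta_level \<nu> n (q - h)) < ereal (b\<^sub>1 + d)"
    unfolding Lq_spectrum_def by (rule Limsup_lessD)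
  moreover have "Lq_spectrum \<nu> (q + h) < ereal (b\<^sub>2 + d)"
    by (rule le_less_trans[OF right]) (use d in simp)
  hence "\<forall>\<^sub>F n in sequentially. ereal (beta_level \<nu> n (q + h)) < ereal (b\<^sub>2 + d)"
    unfolding Lq_spectrum_def by (rule Limsup_lessD)
  \<comment> \<open>This gives \<open>exp (d * L) \<ge> 4\<close>, so that constant factors can be
    absorbed at the price of \<open>d\<close> in the exponent.\<close>
  moreover have "\<forall>\<^sub>F n in sequentially. ln 4 / ln ((2::real) ^ n) < d"
    by (rule eventually_const_over_level_less) (use d in simp)
  ultimately show "\<forall>\<^sub>F n in sequentially. ereal (b\<^sub>0 + ?\<gamma> * q - 2 * d)
      \<le> ereal (log_plus (real (heavy_count \<nu> ?\<alpha> n)) / ln (2 ^ n))"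
    using eventually_gt_at_top[of 0]
  proof eventually_elim
    case (elim n)
    let ?N = "real (heavy_count \<nu> ?\<alpha> n)"
    define L where "L = ln ((2::real) ^ n)"
    have L: "L > 0" using elim by (simp add: L_def)
    have "ln 4 \<le> d * L" using elim L by (simp add: L_def[symmetric] field_simps)
    hence "exp (ln 4) \<le> exp (d * L)" by (simp only: exp_le_cancel_iff)
    hence four: "4 \<le> exp (d * L)" by simp
    note S = charged_sum_eq_exp_beta_level[OF \<open>0 < n\<close>, folded L_def]
    have "exp (L * (b\<^sub>0 - d)) \<le> exp (L * beta_level \<nu> n q)"
      using elim L by simp
    also have "\<dots> \<le> ?N * exp (- (?\<gamma> * L) * q)
        + exp (- (?\<alpha> * L) * h) * exp (L * beta_level \<nu> n (q - h))
        + exp (?\<gamma> * L * h) * exp (L * beta_level \<nu> n (q + h))"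
      unfolding S[symmetric] heavy_count_eq_card_charged L_def[symmetric]
      by (rule tilted_power_sum_bound) (use q h finite_charged_cells in \<open>auto simp: charged_cells_def\<close>)
    also have "\<dots> \<le> ?N * exp (- (?\<gamma> * L) * q)
        + exp (- (?\<alpha> * L) * h) * exp (L * (b\<^sub>1 + d)) + exp (?\<gamma> * L * h) * exp (L * (b\<^sub>2 + d))"
      using elim L by (intro add_mono mult_left_mono) auto
    \<comment> \<open>The window ends are chosen so that both outer terms get the same exponent,
      below \<open>b\<^sub>0\<close> by \<open>c * h - d\<close>.\<close>
    also have "exp (- (?\<alpha> * L) * h) * exp (L * (b\<^sub>1 + d)) = exp (L * (b\<^sub>0 + d - c * h))"
      using h by (simp add: field_simps flip: exp_add)
    also have "exp (?\<gamma> * L * h) * exp (L * (b\<^sub>2 + d)) = exp (L * (b\<^sub>0 + d - c * h))"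
      using h by (simp add: field_simps flip: exp_add)
    finally have 1: "exp (L * (b\<^sub>0 - d)) \<le> ?N * exp (- (?\<gamma> * L) * q) + 2 * exp (L * (b\<^sub>0 + d - c * h))"
      by simp
    \<comment> \<open>Since \<open>4 * d \<le> c * h\<close>, the two outer terms together make up
      at most half of the left-hand side of the bound \<open>1\<close>.\<close>
    have "4 * exp (L * (b\<^sub>0 + d - c * h)) \<le> exp (d * L) * exp (L * (b\<^sub>0 + d - c * h))"
      using four by (intro mult_right_mono) auto
    also have "\<dots> = exp (L * (b\<^sub>0 + 2 * d - c * h))" by (simp add: algebra_simps flip: exp_add)
    also have "\<dots> \<le> exp (L * (b\<^sub>0 - d))" using L d by simp
    finally have "exp (L * (b\<^sub>0 - d)) \<le> 2 * (?N * exp (- (?\<gamma> * L) * q))"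
      using 1 by simp
    hence "exp (L * (b\<^sub>0 - d)) \<le> 4 * (?N * exp (- (?\<gamma> * L) * q))"
      by (rule order_trans) simp
    also have "\<dots> \<le> exp (d * L) * (?N * exp (- (?\<gamma> * L) * q))"
      using four by (intro mult_right_mono) auto
    also have "\<dots> = ?N * exp (d * L - ?\<gamma> * L * q)"
      by (subst mult.left_commute) (simp flip: exp_add)
    finally have "exp (L * (b\<^sub>0 - d)) / exp (d * L - ?\<gamma> * L * q) \<le> ?N"
      by (simp add: pos_divide_le_eq)
    moreover have "L * (b\<^sub>0 - d) - (d * L - ?\<gamma> * L * q) = (b\<^sub>0 + ?\<gamma> * q - 2 * d) * L"
      by (simp add: algebra_simps)
    ultimately have N: "exp ((b\<^sub>0 + ?\<gamma> * q - 2 * d) * L) \<le> ?N" by (simp flip: exp_diff)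
    hence "?N > 0" by (rule less_le_trans[OF exp_gt_zero])
    with N have "(b\<^sub>0 + ?\<gamma> * q - 2 * d) * L \<le> ln ?N" by (simp add: ln_ge_iff)
    also have "\<dots> \<le> log_plus ?N" using \<open>?N > 0\<close> by (simp add: log_plus_def)
    finally show ?case using L by (simp add: L_def[symmetric] pos_le_divide_eq)
  qed
qed

text \<open>A small second difference brings the two window exponents within \<open>3 * c\<close> of
  each other. Then, as \<open>q \<le> b\<^sub>0\<close>, the exponent from
  \<open>F_lower_at_ge\<close> is at least \<open>q * (1 + \<alpha>)\<close> up to a loss of order
  \<open>c\<close>.\<close>

lemma F_lower_ge_of_second_difference:
  assumes q: "0 \<le> q" and h: "0 < h" and c: "0 < c"
    and mid: "ereal b\<^sub>0 \<le> Lq_spectrum_lower \<nu> q" "q \<le> b\<^sub>0" "b\<^sub>0 \<le> b\<^sub>1"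
    and left: "Lq_spectrum \<nu> (q - h) \<le> ereal b\<^sub>1"
    and right: "Lq_spectrum \<nu> (q + h) \<le> ereal b\<^sub>2"
    and diff: "b\<^sub>1 - 2 * b\<^sub>0 + b\<^sub>2 < c * h"
  shows "ereal (q - (3 * q + 1) * c) \<le> F_lower \<nu>"
proof -
  define \<alpha> where "\<alpha> = (b\<^sub>1 - b\<^sub>0) / h + c"
  define \<gamma> where "\<gamma> = (b\<^sub>0 - b\<^sub>2) / h - c"
  \<comment> \<open>The first bound serves \<open>F_lower_at_ge\<close>; the second lets the summand
    1 in \<open>3 * q + 1\<close> pay for \<open>2 * d\<close>.\<close>
  define d where "d = min (c * h / 4) (c / 2)"
  have d: "0 < d" "4 * d \<le> c * h" "2 * d \<le> c" using c h by (auto simp: d_def)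
  have \<alpha>: "\<alpha> > 0" using mid c h by (auto simp: \<alpha>_def intro: add_nonneg_pos)
  have "(b\<^sub>1 - 2 * b\<^sub>0 + b\<^sub>2) / h < c" using diff h by (simp add: field_simps)
  \<comment> \<open>The secant slopes differ by less than \<open>c\<close>, and the two margins add
    \<open>2 * c\<close>.\<close>
  hence \<gamma>: "\<alpha> - 3 * c \<le> \<gamma>" by (simp add: \<alpha>_def \<gamma>_def add_divide_distrib diff_divide_distrib)
  have "(q - (3 * q + 1) * c) * (1 + \<alpha>) = q + \<alpha> * q - (3 * q + 1) * c * (1 + \<alpha>)"
    by (simp add: algebra_simps)
  \<comment> \<open>As \<open>1 + \<alpha> \<ge> 1\<close>, the loss may be taken before division by
    \<open>1 + \<alpha>\<close>.\<close>
  also have "\<dots> \<le> q + \<alpha> * q - (3 * q + 1) * c * 1"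
    using \<alpha> q c by (intro diff_left_mono mult_left_mono) auto
  also have "\<dots> = q + (\<alpha> - 3 * c) * q - c" by (simp add: algebra_simps)
  also have "\<dots> \<le> b\<^sub>0 + \<gamma> * q - 2 * d"
    using mid d q \<gamma> by (intro diff_mono add_mono mult_right_mono) auto
  finally have *: "q - (3 * q + 1) * c \<le> (b\<^sub>0 + \<gamma> * q - 2 * d) / (1 + \<alpha>)"
    using \<alpha> by (simp add: pos_le_divide_eq)
  have "ereal (q - (3 * q + 1) * c) \<le> ereal (b\<^sub>0 + \<gamma> * q - 2 * d) / ereal (1 + \<alpha>)"
    using * \<alpha> by simp
  also have "\<dots> \<le> F_lower_at \<nu> \<alpha> / ereal (1 + \<alpha>)"
    using F_lower_at_ge[OF q h d(1,2) mid(1) left right] \<alpha>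
    by (intro ereal_divide_right_mono) (auto simp: \<alpha>_def \<gamma>_def)
  also have "\<dots> \<le> F_lower \<nu>"
    unfolding F_lower_def using \<alpha> by (intro SUP_upper) simp
  finally show ?thesis .
qed

section \<open>The two kinds of regularity and the conclusion\<close>

text \<open>Nothing is assumed about smoothness, but \<open>ex_small_second_difference\<close> finds
  a point without a noticeable kink in any interval, here arbitrarily close to the upper fixed
  exponent from the left.\<close>

lemma F_lower_ge_if_limit_on_left:
  assumes pos: "0 < upper_fixed_exponent \<nu>" and "\<epsilon> > 0"
    and lim: "\<And>q. q \<in> {upper_fixed_exponent \<nu> - \<epsilon> <..< upper_fixed_exponent \<nu>} \<Longrightarrow>
        Lq_spectrum \<nu> q = Lq_spectrum_lower \<nu> q"
  shows "ereal (upper_fixed_exponent \<nu>) \<le> F_lower \<nu>"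
proof (rule ereal_le_epsilon2)
  define u where "u = upper_fixed_exponent \<nu>"
  fix e :: real assume e: "0 < e"
  \<comment> \<open>Beyond \<open>a\<close> exponents are nonnegative, lie in the range where the
    limit exists, and are within \<open>e / 2\<close> of \<open>u\<close>.\<close>
  define a where "a = max (max 0 (u - \<epsilon>)) (u - e / 2)"
  \<comment> \<open>Makes the loss \<open>(3 * q + 1) * c\<close> at most \<open>e / 2\<close> for
    \<open>q < u\<close>.\<close>
  define c where "c = e / (2 * (3 * u + 1))"
  define f where "f = (\<lambda>q. real_of_ereal (Lq_spectrum \<nu> q))"
  have u: "0 < u" using pos by (simp add: u_def)
  have "a < u" using u \<open>\<epsilon> > 0\<close> e by (simp add: a_def)
  have c: "c > 0" using e u by (simp add: c_def)
  have f: "Lq_spectrum \<nu> q = ereal (f q)" "u \<le> f q" if "a < q" "q < u" for q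
  proof -
    have "ereal u \<le> Lq_spectrum \<nu> q"
      using upper_fixed_exponent_le_Lq_spectrum that by (simp add: u_def)
    moreover have "Lq_spectrum \<nu> q \<le> 1"
      using that by (intro Lq_spectrum_le_one) (simp add: a_def)
    ultimately show "Lq_spectrum \<nu> q = ereal (f q)" "u \<le> f q"
      unfolding f_def by (cases "Lq_spectrum \<nu> q"; simp)+
  qed
  obtain q h where h: "0 < h" "a < q - h" "q + h < u" "f (q - h) - 2 * f q + f (q + h) < c * h"
    using ex_small_second_difference[OF \<open>a < u\<close> c] by blast
  have q: "a < q" "q < u" using h by auto
  hence "0 \<le> q" "u - e / 2 < q" by (auto simp: a_def)
  have "f q \<le> f (q - h)"
    using Lq_spectrum_antimono[of "q - h" q] h q by (simp add: f)
  moreover have "Lq_spectrum_lower \<nu> q = ereal (f q)"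
    using lim[of q] f(1)[OF q] q by (auto simp: a_def u_def)
  moreover have "Lq_spectrum \<nu> (q - h) = ereal (f (q - h))" "Lq_spectrum \<nu> (q + h) = ereal (f (q + h))"
    using h by (auto intro!: f(1))
  ultimately have "ereal (q - (3 * q + 1) * c) \<le> F_lower \<nu>"
    using f(2)[OF q] q(2)
    by (intro F_lower_ge_of_second_difference[OF \<open>0 \<le> q\<close> h(1) c _ _ _ _ _ h(4)]) auto
  moreover have "u - e \<le> q - (3 * q + 1) * c"
  proof -
    have "(3 * q + 1) * c \<le> (3 * u + 1) * c" using q c by (intro mult_right_mono) auto
    also have "\<dots> = e / 2" using u by (simp add: c_def field_simps)
    finally show ?thesis using \<open>u - e / 2 < q\<close> by simp
  qed
  ultimately have "ereal (u - e) \<le> F_lower \<nu>" by (meson ereal_less_eq(3) order_trans)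
  thus "ereal (upper_fixed_exponent \<nu>) \<le> F_lower \<nu> + ereal e"
    unfolding u_def by (cases "F_lower \<nu>") auto
qed

text \<open>Differentiability rules out a kink at the upper fixed exponent itself, so
  \<open>q\<close> can be that exponent and \<open>h\<close> any small enough step.\<close>

lemma F_lower_ge_if_differentiable:
  assumes lim: "Lq_spectrum \<nu> (upper_fixed_exponent \<nu>) = Lq_spectrum_lower \<nu> (upper_fixed_exponent \<nu>)"
    and diff: "ereal_differentiable_at (Lq_spectrum \<nu>) (upper_fixed_exponent \<nu>)"
  shows "ereal (upper_fixed_exponent \<nu>) \<le> F_lower \<nu>"
proof (rule ereal_le_epsilon2)
  define u where "u = upper_fixed_exponent \<nu>"
  fix e :: real assume e: "0 < e"
  define c where "c = e / (3 * u + 1)"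
  define f where "f = (\<lambda>q. real_of_ereal (Lq_spectrum \<nu> q))"
  have u: "0 \<le> u" using upper_fixed_exponent_nonneg by (simp add: u_def)
  have c: "c > 0" using e u by (simp add: c_def)
  have fin: "\<forall>\<^sub>F q in nhds u. Lq_spectrum \<nu> q = ereal (f q)" and df: "f differentiable (at u)"
    using diff by (auto simp: ereal_differentiable_at_def u_def f_def ereal_real elim!: eventually_mono)
  \<comment> \<open>The bound \<open>u \<le> f q\<close> is so far known only for
    \<open>q < u\<close>; continuity carries it to \<open>u\<close>.\<close>
  have "isCont f u" using df by (rule differentiable_imp_continuous_within)
  hence "(f \<longlongrightarrow> f u) (at_left u)"
    unfolding isCont_def by (rule tendsto_mono[rotated]) (simp add: at_le)
  moreover have "\<forall>\<^sub>F q in at_left u. u \<le> f q"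
    unfolding eventually_at_filter using fin
    by eventually_elim (use upper_fixed_exponent_le_Lq_spectrum in \<open>force simp: u_def\<close>)
  ultimately have fu: "u \<le> f u" by (rule tendsto_lowerbound) simp
  have uu: "Lq_spectrum \<nu> u = ereal (f u)" using fin by (rule eventually_nhds_x_imp_x)
  have sh: "\<forall>\<^sub>F h in at_right 0. Lq_spectrum \<nu> (g h) = ereal (f (g h))"
    if "(g \<longlongrightarrow> u) (at_right 0)" for g :: "real \<Rightarrow> real"
    using that fin by (auto simp: filterlim_iff)
  have "\<forall>\<^sub>F h in at_right 0. Lq_spectrum \<nu> (u - h) = ereal (f (u - h))"
    "\<forall>\<^sub>F h in at_right 0. Lq_spectrum \<nu> (u + h) = ereal (f (u + h))"
    by (rule sh, auto intro!: tendsto_eq_intros)+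
  hence "\<forall>\<^sub>F h in at_right 0. 0 < h \<and> Lq_spectrum \<nu> (u - h) = ereal (f (u - h)) \<and>
      Lq_spectrum \<nu> (u + h) = ereal (f (u + h)) \<and> f (u - h) - 2 * f u + f (u + h) < c * h"
    using differentiable_second_difference[OF df c] eventually_at_right_less[of 0]
    by eventually_elim auto
  then obtain h where h: "0 < h" "Lq_spectrum \<nu> (u - h) = ereal (f (u - h))"
      "Lq_spectrum \<nu> (u + h) = ereal (f (u + h))" "f (u - h) - 2 * f u + f (u + h) < c * h"
    using eventually_happens'[OF trivial_limit_at_right_real] by blast
  have "f u \<le> f (u - h)"
    using Lq_spectrum_antimono[of "u - h" u] h uu by simp
  hence "ereal (u - (3 * u + 1) * c) \<le> F_lower \<nu>"
    using h u c fu uu lim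
    by (intro F_lower_ge_of_second_difference[where h = h and b\<^sub>0 = "f u"
          and b\<^sub>1 = "f (u - h)" and b\<^sub>2 = "f (u + h)"]) (auto simp: u_def[symmetric])
  moreover have "(3 * u + 1) * c = e" using u by (simp add: c_def)
  ultimately show "ereal (upper_fixed_exponent \<nu>) \<le> F_lower \<nu> + ereal e"
    unfolding u_def by (cases "F_lower \<nu>") auto
qed

end

theorem theorem1p2:
  fixes \<nu> :: "real measure"
  assumes "borel_measure_on_unit \<nu>"
    and "emeasure \<nu> UNIV \<noteq> 0"
    and "Lq_regular \<nu>"
  shows "MF_regular \<nu>"
proof -
  have "ereal (upper_fixed_exponent \<nu>) \<le> F_lower \<nu>"
  \<comment> \<open>At 0 the claim is mere nonnegativity; the lemma for case (a) requires room for
    nonnegative exponents to the left.\<close>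
  proof (cases "upper_fixed_exponent \<nu> = 0")
    case True
    thus ?thesis using F_lower_nonneg by (simp add: zero_ereal_def)
  next
    case False
    hence "0 < upper_fixed_exponent \<nu>"
      using upper_fixed_exponent_nonneg[OF assms(1,2)] by simp
    with assms(3) show ?thesis
      unfolding Lq_regular_def
      using F_lower_ge_if_limit_on_left[OF assms(1,2)] F_lower_ge_if_differentiable[OF assms(1,2)]
      by blast
  qed
  with F_lower_le_F_upper F_upper_le[OF assms(1,2)] show ?thesis
    unfolding MF_regular_def by (meson order.antisym order_trans)
qed

end
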